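(* Let $G$ be a finite connected graph with subdivision number $\eta$, let $capt$ be the number of rounds needed for the single cop to win the Robber Locating Game on $G^{1/\eta}$, and let $\delta$ be the diameter of $G$. Then the localization number of $G$ satisfies $\zeta(G)=O\big(2^{capt/\eta}\,16^{\eta}\,\delta^{2\eta}\big)$.
   Context: Robber Locating Game on a graph: an invisible robber first chooses a vertex. In each round, the cops first simultaneously probe vertices anywhere in the graph, each probe returning the graph distance from the probed vertex to the robber's current position; then the robber moves to an adjacent vertex or stays put. The cops win when the set of robber positions consistent with all information has size $1$. A graph is localizable with $k$ cops if the cops have a strategy guaranteeing a win in finite time. The localization number $\zeta(G)$ is the minimum number of cops for which $G$ is localizable. For an integer $m\ge 1$, $G^{1/m}$ is the graph obtained from $G$ by replacing each edge with a path of length $m$. The subdivision number $\eta$ of $G$ is the minimum $m$ such that $G^{1/m}$ is localizable with one cop. The capture time $capt$ is the minimum number of rounds within which a single cop can guarantee to locate the robber on $G^{1/\eta}$. *)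

theory Defs
  imports
    Complex_Main
    "HOL-Library.Multiset"
    "Graph_Theory.Graph_Theory"
begin

text \<open>
  A finite simple undirected graph is a \<^typ>\<open>'a pair_pre_digraph\<close> satisfying \<^locale>\<open>pair_graph\<close>:
  finite, loop-free, and with every edge present as a pair of opposite arcs.
\<close>

definition gdist :: "'a pair_pre_digraph \<Rightarrow> 'a \<Rightarrow> 'a \<Rightarrow> nat" where
  "gdist G u v =
     (LEAST n. \<exists>p. vwalk p (with_proj G) \<and> hd p = u \<and> last p = v \<and> vwalk_length p = n)"

definition graph_diameter :: "'a pair_pre_digraph \<Rightarrow> nat" where
  "graph_diameter G = Max {gdist G u v | u v. u \<in> pverts G \<and> v \<in> pverts G}"


text \<open>
  Vertices of the subdivided graph are multisets of size \<open>m\<close>: the point at distance \<open>i\<close> from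
  \<open>u\<close> on the path replacing the edge \<open>uv\<close> is \<open>m - i\<close> copies of \<open>u\<close> together with \<open>i\<close> copies
  of \<open>v\<close>. So the point is the same when described from the other end
  (\<open>subdiv_point m u v i = subdiv_point m v u (m - i)\<close>), and the original vertex \<open>u\<close> becomes
  \<open>m\<close> copies of \<open>u\<close>, whichever edge at \<open>u\<close> is considered.
\<close>

definition subdiv_point :: "nat \<Rightarrow> 'a \<Rightarrow> 'a \<Rightarrow> nat \<Rightarrow> 'a multiset" where
  "subdiv_point m u v i = replicate_mset (m - i) u + replicate_mset i v"

definition uniform_subdivision :: "nat \<Rightarrow> 'a pair_pre_digraph \<Rightarrow> 'a multiset pair_pre_digraph" where
  "uniform_subdivision m G =
     \<lparr> pverts = {replicate_mset m u | u. u \<in> pverts G}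
              \<union> {subdiv_point m u v i | u v i. (u, v) \<in> parcs G \<and> i \<le> m},
       parcs = {(subdiv_point m u v i, subdiv_point m u v (Suc i)) | u v i.
                  (u, v) \<in> parcs G \<and> i < m}
             \<union> {(subdiv_point m u v (Suc i), subdiv_point m u v i) | u v i.
                  (u, v) \<in> parcs G \<and> i < m} \<rparr>"


text \<open>
  Rounds are numbered from 0; \<open>r n\<close> is the robber's position when the probes of round \<open>n\<close> are made.
\<close>

definition robber_play :: "'a pair_pre_digraph \<Rightarrow> (nat \<Rightarrow> 'a) \<Rightarrow> bool" where
  "robber_play G r \<longleftrightarrow>
     (\<forall>n. r n \<in> pverts G) \<and> (\<forall>n. r (Suc n) = r n \<or> (r n, r (Suc n)) \<in> parcs G)"

text \<open>
  A strategy maps the answers received so far (one list per round, one entry per cop) to the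
  vertices probed next. The earlier probes are determined by the strategy and these answers.
\<close>

type_synonym 'a cop_strategy = "nat list list \<Rightarrow> 'a list"

definition cop_strategy :: "'a pair_pre_digraph \<Rightarrow> nat \<Rightarrow> 'a cop_strategy \<Rightarrow> bool" where
  "cop_strategy G k \<sigma> \<longleftrightarrow> (\<forall>h. length (\<sigma> h) = k \<and> set (\<sigma> h) \<subseteq> pverts G)"

fun answers :: "'a pair_pre_digraph \<Rightarrow> 'a cop_strategy \<Rightarrow> (nat \<Rightarrow> 'a) \<Rightarrow> nat \<Rightarrow> nat list list" where
  "answers G \<sigma> r 0 = []"
| "answers G \<sigma> r (Suc n) =
     answers G \<sigma> r n @ [map (\<lambda>p. gdist G p (r n)) (\<sigma> (answers G \<sigma> r n))]"

text \<open>Positions consistent with all information once the probes of round \<open>n\<close> are answered.\<close>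

definition possible_positions ::
    "'a pair_pre_digraph \<Rightarrow> 'a cop_strategy \<Rightarrow> (nat \<Rightarrow> 'a) \<Rightarrow> nat \<Rightarrow> 'a set" where
  "possible_positions G \<sigma> r n =
     {r' n | r'. robber_play G r' \<and> answers G \<sigma> r' (Suc n) = answers G \<sigma> r (Suc n)}"

definition wins_within :: "'a pair_pre_digraph \<Rightarrow> nat \<Rightarrow> nat \<Rightarrow> bool" where
  "wins_within G k t \<longleftrightarrow>
     (\<exists>\<sigma>. cop_strategy G k \<sigma> \<and>
        (\<forall>r. robber_play G r \<longrightarrow> (\<exists>n<t. card (possible_positions G \<sigma> r n) = 1)))"

definition localizable :: "'a pair_pre_digraph \<Rightarrow> nat \<Rightarrow> bool" where
  "localizable G k \<longleftrightarrow> (\<exists>t. wins_within G k t)"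

definition localization_number :: "'a pair_pre_digraph \<Rightarrow> nat" where
  "localization_number G = (LEAST k. localizable G k)"

definition is_subdivision_number :: "'a pair_pre_digraph \<Rightarrow> nat \<Rightarrow> bool" where
  "is_subdivision_number G m \<longleftrightarrow>
     m \<ge> 1 \<and> localizable (uniform_subdivision m G) 1 \<and>
     (\<forall>m'. 1 \<le> m' \<and> m' < m \<longrightarrow> \<not> localizable (uniform_subdivision m' G) 1)"

definition capture_time :: "'a pair_pre_digraph \<Rightarrow> nat" where
  "capture_time H = (LEAST t. wins_within H 1 t)"

end

theory Submission
  imports Defs
begin

text \<open>
  A robber on \<open>G\<close> who moves along an edge (or stays) in one round is lifted to a robber on
  \<open>G\<^bsup>1/m\<^esup>\<close> who needs \<open>m\<close> rounds for this. The distance from a point \<open>x\<close> of \<open>G\<^bsup>1/m\<^esup>\<close> to the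
  lifted robber is determined by the distances in \<open>G\<close> from the ends of the edge of \<open>x\<close> to the
  robber's positions before and after his move, and by whether he moves at all, as long as those
  ends do not coincide with one of the two positions, in which case he is found anyway. Moreover,
  \<open>x\<close>, the time, and the bit stay/move leave at most \<open>4\<delta>\<close> values for this distance.

  In round \<open>N\<close> on \<open>G\<close>, the answers that the single cop got in the first \<open>m (N - 1)\<close> rounds are
  therefore known up to a guess of the stay/move bits. The many cops branch over the at most
  \<open>2\<^bsup>N+1\<^esup>\<close> guesses and over the at most \<open>(4\<delta>)\<^bsup>d\<^esup>\<close> continuations by \<open>d \<le> 2m\<close> further
  answers, and for every branch probe the ends of the edge containing the next probe of the single
  cop and of the edge on which he has located his robber. Once the single cop wins on the branch
  that corresponds to the actual play, one of these probes hits the robber.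
\<close>

section \<open>Distances as least lengths of arc powers\<close>

text \<open>Relation powers can be split or extended at either end, so all later distance arguments
  use them instead of vertex lists. The start has to be a vertex: the power 0 relates any
  \<open>u\<close> to itself, but a trivial walk must lie in the graph.\<close>

lemma vwalk_iff_relpow:
  assumes "pair_wf_digraph G" and "u \<in> pverts G"
  shows "(\<exists>p. vwalk p (with_proj G) \<and> hd p = u \<and> last p = v \<and> vwalk_length p = n)
    \<longleftrightarrow> (u, v) \<in> parcs G ^^ n"
  using assms(2)
proof (induction n arbitrary: u)
  case 0
  show ?case
  proof
    assume "\<exists>p. vwalk p (with_proj G) \<and> hd p = u \<and> last p = v \<and> vwalk_length p = 0"
    then obtain p where p: "p \<noteq> []" "hd p = u" "last p = v" "length p \<le> 1"
      by (auto simp: vwalk_def)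
    then show "(u, v) \<in> parcs G ^^ 0" by (cases p) auto
  next
    assume "(u, v) \<in> parcs G ^^ 0"
    then show "\<exists>p. vwalk p (with_proj G) \<and> hd p = u \<and> last p = v \<and> vwalk_length p = 0"
      using 0 by (intro exI[of _ "[u]"]) (auto simp: vwalk_def)
  qed
next
  case (Suc n)
  show ?case
  proof
    assume "\<exists>p. vwalk p (with_proj G) \<and> hd p = u \<and> last p = v \<and> vwalk_length p = Suc n"
    then obtain p where p: "vwalk p (with_proj G)" "hd p = u" "last p = v" "length p = Suc (Suc n)"
      by auto
    then obtain w q where q: "p = u # w # q" by (cases p; cases "tl p") auto
    have "vwalk (w # q) (with_proj G)" "(u, w) \<in> parcs G"
      using p(1) unfolding q by (auto simp: vwalk_def)
    then have "(w, v) \<in> parcs G ^^ n"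
      using Suc.IH[of w] p q by (auto simp: vwalk_def intro!: exI[of _ "w # q"])
    with \<open>(u, w) \<in> parcs G\<close> show "(u, v) \<in> parcs G ^^ Suc n" by (rule relpow_Suc_I2)
  next
    assume "(u, v) \<in> parcs G ^^ Suc n"
    then obtain w where w: "(u, w) \<in> parcs G" "(w, v) \<in> parcs G ^^ n" by (rule relpow_Suc_E2)
    then have "w \<in> pverts G" using pair_wf_digraph.arc_snd_in_verts[OF assms(1)] by force
    with w Suc.IH obtain p where p: "vwalk p (with_proj G)" "hd p = w" "last p = v"
      "vwalk_length p = n" by blast
    moreover have "p \<noteq> []" using p by (auto simp: vwalk_def)
    moreover from this have "length p = Suc n" using p by (cases p) auto
    ultimately show "\<exists>p. vwalk p (with_proj G) \<and> hd p = u \<and> last p = v \<and> vwalk_length p = Suc n"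
      using w Suc.prems by (intro exI[of _ "u # p"]) (auto intro!: vwalk_consI)
  qed
qed

lemma gdist_eq_Least:
  assumes "pair_wf_digraph G" and "u \<in> pverts G"
  shows "gdist G u v = (LEAST n. (u, v) \<in> parcs G ^^ n)"
  unfolding gdist_def by (simp only: vwalk_iff_relpow[OF assms])

lemma gdist_le:
  assumes "pair_wf_digraph G" and "u \<in> pverts G" and "(u, v) \<in> parcs G ^^ n"
  shows "gdist G u v \<le> n"
  unfolding gdist_eq_Least[OF assms(1,2)] using assms(3) by (rule Least_le)

lemma gdist_relpow:
  assumes "pair_wf_digraph G" and "u \<in> pverts G" and "(u, v) \<in> parcs G ^^ n"
  shows "(u, v) \<in> parcs G ^^ gdist G u v"
  unfolding gdist_eq_Least[OF assms(1,2)] using assms(3) by (rule LeastI)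

lemma relpow_sym:
  assumes "sym R" and "(u, v) \<in> R ^^ n"
  shows "(v, u) \<in> R ^^ n"
  using assms(2)
proof (induction n arbitrary: v)
  case (Suc n)
  then obtain w where "(u, w) \<in> R ^^ n" "(w, v) \<in> R" by (auto elim: relpow_Suc_E)
  with Suc.IH assms(1) show ?case by (meson relpow_Suc_I2 symD)
qed simp

section \<open>The uniform subdivision\<close>

lemma set_subdiv_point: "set_mset (subdiv_point m u v i) \<subseteq> {u, v}"
  by (auto simp: subdiv_point_def split: if_splits)

lemma subdiv_point_0: "subdiv_point m u v 0 = replicate_mset m u"
  by (simp add: subdiv_point_def)

lemma subdiv_point_end: "subdiv_point m u v m = replicate_mset m v"
  by (simp add: subdiv_point_def)

lemma subdiv_point_flip: "i \<le> m \<Longrightarrow> subdiv_point m u v i = subdiv_point m v u (m - i)"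
  by (simp add: subdiv_point_def)

text \<open>The degenerate edge \<open>u = v\<close> lets a robber who stays for a round be lifted
  by the same formula as one who moves.\<close>

lemma subdiv_point_same: "i \<le> m \<Longrightarrow> subdiv_point m u u i = replicate_mset m u"
  by (auto simp: subdiv_point_def multiset_eq_iff)

locale subdivided_graph = pair_graph G for G :: "'a pair_pre_digraph" +
  fixes m :: nat
  assumes conn: "Digraph_Component.connected (with_proj G)" and m_pos: "m \<ge> 1"
begin

abbreviation H :: "'a multiset pair_pre_digraph" where
  "H \<equiv> uniform_subdivision m G"

lemma pverts_ne: "pverts G \<noteq> {}"
  using conn by (auto simp: connected_conv)

lemma arc_verts: "(u, v) \<in> parcs G \<Longrightarrow> u \<in> pverts G \<and> v \<in> pverts G"
  using arc_fst_in_verts arc_snd_in_verts by force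

lemma arc_neq: "(u, v) \<in> parcs G \<Longrightarrow> u \<noteq> v"
  using pair_no_loops by force

lemma arc_sym: "(u, v) \<in> parcs G \<Longrightarrow> (v, u) \<in> parcs G"
  by (rule arcs_symmetric)

lemma reach:
  assumes "u \<in> pverts G" "v \<in> pverts G"
  shows "\<exists>n. (u, v) \<in> parcs G ^^ n"
proof -
  have "strongly_connected (with_proj G)"
    using symmetric_connected_imp_strongly_connected pair_sym_arcs conn by simp
  then have "u \<rightarrow>\<^sup>*\<^bsub>with_proj G\<^esub> v" using assms by (auto simp: strongly_connected_def)
  then obtain p where "vwalk p (with_proj G)" "hd p = u" "last p = v"
    by (auto simp: reachable_vwalk_conv)
  then show ?thesis using vwalk_iff_relpow[OF pair_wf_digraph_axioms assms(1)] by blast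
qed

lemma gdist_path:
  assumes "u \<in> pverts G" "v \<in> pverts G"
  shows "(u, v) \<in> parcs G ^^ gdist G u v"
  using reach[OF assms] gdist_relpow[OF pair_wf_digraph_axioms assms(1)] by blast

lemma gdist_zero_iff:
  assumes "u \<in> pverts G" "v \<in> pverts G"
  shows "gdist G u v = 0 \<longleftrightarrow> u = v"
proof
  assume "gdist G u v = 0"
  then show "u = v" using gdist_path[OF assms] by simp
next
  assume "u = v"
  then have "gdist G u v \<le> 0" using assms by (intro gdist_le[OF pair_wf_digraph_axioms]) auto
  then show "gdist G u v = 0" by simp
qed

lemma gdist_step:
  assumes "u \<in> pverts G" "(v, w) \<in> parcs G"
  shows "gdist G u w \<le> gdist G u v + 1"
proof -
  have "(u, w) \<in> parcs G ^^ Suc (gdist G u v)"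
    using gdist_path[of u v] assms arc_verts by (meson relpow_Suc_I)
  then show ?thesis using gdist_le[OF pair_wf_digraph_axioms assms(1)] by force
qed

lemma finite_gdists: "finite {gdist G u v |u v. u \<in> pverts G \<and> v \<in> pverts G}"
proof -
  have "{gdist G u v |u v. u \<in> pverts G \<and> v \<in> pverts G}
    = (\<lambda>(u, v). gdist G u v) ` (pverts G \<times> pverts G)" by auto
  then show ?thesis using pair_finite_verts by simp
qed

lemma gdist_le_diameter:
  assumes "u \<in> pverts G" "v \<in> pverts G"
  shows "gdist G u v \<le> graph_diameter G"
  unfolding graph_diameter_def using assms by (intro Max_ge finite_gdists) blast

lemma pverts_H_iff:
  "x \<in> pverts H \<longleftrightarrow> (\<exists>u v i. u \<in> pverts G \<and> (u = v \<or> (u, v) \<in> parcs G) \<and> i \<le> m \<and>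
      x = subdiv_point m u v i)"
proof
  assume "x \<in> pverts H"
  then consider u where "u \<in> pverts G" "x = replicate_mset m u"
    | u v i where "(u, v) \<in> parcs G" "i \<le> m" "x = subdiv_point m u v i"
    by (auto simp: uniform_subdivision_def)
  then show "\<exists>u v i. u \<in> pverts G \<and> (u = v \<or> (u, v) \<in> parcs G) \<and> i \<le> m \<and>
      x = subdiv_point m u v i"
    by cases (metis subdiv_point_0 le0, metis arc_verts)
next
  assume "\<exists>u v i. u \<in> pverts G \<and> (u = v \<or> (u, v) \<in> parcs G) \<and> i \<le> m \<and>
      x = subdiv_point m u v i"
  then show "x \<in> pverts H"
    by (auto simp: uniform_subdivision_def subdiv_point_same)
qed

lemma subdiv_point_in_H:
  assumes "u \<in> pverts G" "u = v \<or> (u, v) \<in> parcs G" "i \<le> m"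
  shows "subdiv_point m u v i \<in> pverts H"
  using assms pverts_H_iff by blast

lemma arc_H_I:
  assumes "(u, v) \<in> parcs G" "i < m"
  shows "(subdiv_point m u v i, subdiv_point m u v (Suc i)) \<in> parcs H"
  using assms by (auto simp: uniform_subdivision_def)

lemma arc_H_cases:
  assumes "(x, y) \<in> parcs H"
  obtains u v i where "(u, v) \<in> parcs G" "i < m"
    "x = subdiv_point m u v i" "y = subdiv_point m u v (Suc i)"
proof -
  consider u v i where "(u, v) \<in> parcs G" "i < m"
    "x = subdiv_point m u v i" "y = subdiv_point m u v (Suc i)"
  | u v i where "(u, v) \<in> parcs G" "i < m"
    "x = subdiv_point m u v (Suc i)" "y = subdiv_point m u v i"
    using assms by (auto simp: uniform_subdivision_def)
  then show thesis
  proof cases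
    \<comment> \<open>A backward arc is a forward arc of the reversed edge, starting
      \<open>m - Suc i\<close> steps from \<open>v\<close>.\<close>
    case (2 u v i)
    then show ?thesis
      using that[of v u "m - Suc i"] arc_sym subdiv_point_flip[of "Suc i" m u v]
        subdiv_point_flip[of i m u v] Suc_diff_Suc[of i m] by simp
  qed (rule that)
qed

lemma sym_H: "sym (parcs H)"
  by (rule symI) (auto simp: uniform_subdivision_def)

lemma wf_H: "pair_wf_digraph H"
  by unfold_locales (use arc_verts in \<open>auto elim!: arc_H_cases intro!: subdiv_point_in_H\<close>)

lemma set_pverts_H:
  assumes "x \<in> pverts H"
  shows "set_mset x \<subseteq> pverts G" "card (set_mset x) \<le> 2" "x \<noteq> {#}"
proof -
  obtain u v i where x: "u \<in> pverts G" "u = v \<or> (u, v) \<in> parcs G" "i \<le> m"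
    "x = subdiv_point m u v i" using assms pverts_H_iff by auto
  then have *: "set_mset x \<subseteq> {u, v}" using set_subdiv_point by metis
  then show "set_mset x \<subseteq> pverts G" using x arc_verts by auto
  have "card (set_mset x) \<le> card {u, v}" using * by (intro card_mono) auto
  also have "\<dots> \<le> 2" by (simp add: card_insert_if)
  finally show "card (set_mset x) \<le> 2" .
  have "size x = m" using x by (simp add: subdiv_point_def)
  then show "x \<noteq> {#}" using m_pos by auto
qed

lemma path_along_edge:
  assumes "(u, v) \<in> parcs G" "i \<le> m"
  shows "(subdiv_point m u v 0, subdiv_point m u v i) \<in> parcs H ^^ i"
  using assms(2)
proof (induction i)
  case (Suc i)
  then show ?case using arc_H_I[OF assms(1), of i] by (auto intro: relpow_Suc_I)
qed simp

section \<open>Routes and distances in the subdivided graph\<close>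

lemma path_to_end:
  assumes "x \<in> pverts H" "p \<in># x"
  shows "(replicate_mset m p, x) \<in> parcs H ^^ (m - count x p)"
proof -
  obtain u v i where x: "u \<in> pverts G" "u = v \<or> (u, v) \<in> parcs G" "i \<le> m"
    "x = subdiv_point m u v i" using assms pverts_H_iff by auto
  show ?thesis
  proof (cases "u = v")
    case True
    then have "x = replicate_mset m u" using x subdiv_point_same by simp
    moreover from this have "p = u" using assms(2) by (simp split: if_splits)
    ultimately show ?thesis by simp
  next
    case False
    with x have uv: "(u, v) \<in> parcs G" by simp
    have "p = u \<or> p = v" using assms(2) x set_subdiv_point by fastforce
    then show ?thesis
    proof
      assume "p = u"
      then have "m - count x p = i" using x False by (simp add: subdiv_point_def)
      then show ?thesis using path_along_edge[OF uv x(3)] x \<open>p = u\<close> by (simp add: subdiv_point_0)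
    next
      assume "p = v"
      then have "m - count x p = m - i" using x False by (simp add: subdiv_point_def)
      then show ?thesis using path_along_edge[OF arc_sym[OF uv], of "m - i"] x \<open>p = v\<close>
        by (simp add: subdiv_point_0 subdiv_point_flip[OF x(3)])
    qed
  qed
qed

lemma path_subdivided:
  assumes "(p, q) \<in> parcs G ^^ n"
  shows "(replicate_mset m p, replicate_mset m q) \<in> parcs H ^^ (m * n)"
  using assms
proof (induction n arbitrary: q)
  case (Suc n)
  then obtain w where w: "(p, w) \<in> parcs G ^^ n" "(w, q) \<in> parcs G" by (auto elim: relpow_Suc_E)
  have "(replicate_mset m w, replicate_mset m q) \<in> parcs H ^^ m"
    using path_along_edge[OF w(2), of m] by (simp add: subdiv_point_0 subdiv_point_end)
  with Suc.IH[OF w(1)] show ?case by (auto simp: relpow_add add.commute[of m])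
qed simp

text \<open>A point with \<open>count x p\<close> copies of \<open>p\<close> lies
  \<open>m - count x p\<close> steps from the end \<open>p\<close> of its edge. So this is the
  length of the route that leaves the edge of \<open>x\<close> at \<open>p\<close> and enters the
  edge of \<open>y\<close> at \<open>q\<close>.\<close>

definition via :: "'a multiset \<Rightarrow> 'a multiset \<Rightarrow> 'a \<Rightarrow> 'a \<Rightarrow> nat" where
  "via x y p q = (m - count x p) + m * gdist G p q + (m - count y q)"

lemma path_via:
  assumes "x \<in> pverts H" "y \<in> pverts H" "p \<in># x" "q \<in># y"
  shows "(x, y) \<in> parcs H ^^ via x y p q"
proof -
  have "(x, replicate_mset m p) \<in> parcs H ^^ (m - count x p)"
    using relpow_sym[OF sym_H path_to_end[OF assms(1,3)]] .
  moreover have "(replicate_mset m p, replicate_mset m q) \<in> parcs H ^^ (m * gdist G p q)"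
    using assms set_pverts_H(1) by (intro path_subdivided gdist_path) auto
  moreover have "(replicate_mset m q, y) \<in> parcs H ^^ (m - count y q)"
    using path_to_end[OF assms(2,4)] .
  ultimately show ?thesis unfolding via_def relpow_add by blast
qed

text \<open>Here \<open>count x b\<close> is the distance from \<open>x\<close> to \<open>a\<close>
  along the edge. If \<open>a\<close> is not an end of \<open>x\<close>, then \<open>x\<close> is
  the original vertex \<open>b\<close>, and the whole edge, of length \<open>m\<close>, is charged
  to the middle part of the route.\<close>

lemma via_along_edge:
  assumes "(a, b) \<in> parcs G" "set_mset x \<subseteq> {a, b}" "count x a + count x b = m"
    and "count x b \<le> n" "y = replicate_mset m a"
  shows "\<exists>p. p \<in># x \<and> via x y p a \<le> n"
proof (cases "a \<in># x")
  case True
  have "gdist G a a = 0" using gdist_zero_iff arc_verts assms(1) by blast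
  then show ?thesis using True assms by (intro exI[of _ a]) (auto simp: via_def)
next
  case False
  have "gdist G b a \<le> 1"
    using gdist_step[OF _ arc_sym[OF assms(1)], of b] gdist_zero_iff[of b b] arc_verts assms(1)
    by auto
  then have "m * gdist G b a \<le> m" by simp
  moreover have "count x b = m" using False assms(3) by (simp add: not_in_iff)
  moreover from this have "via x y b a = m * gdist G b a" using assms(5) by (simp add: via_def)
  moreover have "b \<in># x"
    using \<open>count x b = m\<close> m_pos by (simp add: count_greater_zero_iff[symmetric])
  ultimately show ?thesis using assms(4) by (metis order_trans)
qed

text \<open>
  A walk leaves the edge containing its start only through an end of that edge; until then
  its length is bounded below by the change of the position on the edge.
\<close>

lemma walk_cases:
  assumes "x \<in> pverts H" "(x, y) \<in> parcs H ^^ n"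
  shows "(\<exists>p q. p \<in># x \<and> q \<in># y \<and> via x y p q \<le> n) \<or>
    (\<exists>a b. (a, b) \<in> parcs G \<and> set_mset x \<union> set_mset y \<subseteq> {a, b} \<and>
       count x a + count x b = m \<and> count y a + count y b = m \<and>
       count x a \<le> count y a + n \<and> count y a \<le> count x a + n)"
    (is "?through y n \<or> ?edge y n")
  using assms(2)
proof (induction n arbitrary: y)
  case 0
  then have [simp]: "y = x" by simp
  obtain u v i where x: "u \<in> pverts G" "u = v \<or> (u, v) \<in> parcs G" "i \<le> m"
    "x = subdiv_point m u v i" using assms(1) pverts_H_iff by auto
  show ?case
  proof (cases "u = v")
    case True
    then have "x = replicate_mset m u" using x subdiv_point_same by simp
    moreover have "gdist G u u = 0" using gdist_zero_iff x(1) by blast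
    ultimately have "?through y 0" using m_pos
      by (intro exI[of _ u]) (auto simp: via_def)
    then show ?thesis ..
  next
    case False
    with x have uv: "(u, v) \<in> parcs G" by simp
    have "count x u + count x v = m" using x False by (simp add: subdiv_point_def)
    with uv have "?edge y 0" using set_subdiv_point[of m u v i] x(4)
      by (intro exI[of _ u] exI[of _ v]) auto
    then show ?thesis ..
  qed
next
  case (Suc n)
  then obtain z where z: "(x, z) \<in> parcs H ^^ n" "(z, y) \<in> parcs H" by (auto elim: relpow_Suc_E)
  from z(2) obtain c d i where cd: "(c, d) \<in> parcs G" "i < m"
    and zy: "z = subdiv_point m c d i" "y = subdiv_point m c d (Suc i)" by (rule arc_H_cases)
  have "c \<noteq> d" using cd arc_neq by blast
  then have cnt: "count z c = m - i" "count z d = i" "count y c = m - Suc i" "count y d = Suc i"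
    using zy by (auto simp: subdiv_point_def)
  have sets: "set_mset z \<subseteq> {c, d}" "set_mset y \<subseteq> {c, d}"
    using zy set_subdiv_point by metis+
  have "d \<in># y" using cnt by (simp add: count_greater_zero_iff[symmetric])
  \<comment> \<open>The step from \<open>z\<close> to \<open>y\<close> goes away from
    \<open>c\<close> towards \<open>d\<close>. A route entering at \<open>d\<close> gets shorter and
    one entering at \<open>c\<close> longer by one. If \<open>c\<close> is no longer an end of
    \<open>y\<close>, then \<open>y\<close> is the original vertex \<open>d\<close>, and the
    completed edge moves into the distance in \<open>G\<close>.\<close>
  have through: "?through y (Suc n)" if "p \<in># x" "q \<in># z" "via x z p q \<le> n" for p q
  proof -
    have "p \<in> pverts G" using that(1) set_pverts_H(1)[OF assms(1)] by auto
    consider "q = d" | "q = c" "c \<in># y" | "q = c" "c \<notin># y" using \<open>q \<in># z\<close> sets(1) by blast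
    then show ?thesis
    proof cases
      case 1
      then show ?thesis using that cnt \<open>d \<in># y\<close>
        by (intro exI[of _ p] exI[of _ d]) (auto simp: via_def)
    next
      case 2
      then show ?thesis using that cnt cd
        by (intro exI[of _ p] exI[of _ c]) (auto simp: via_def)
    next
      case 3
      then have "Suc i = m" using cnt cd(2) by (simp add: not_in_iff)
      have "m * gdist G p d \<le> m * gdist G p c + m"
        using mult_le_mono2[OF gdist_step[OF \<open>p \<in> pverts G\<close> cd(1)], of m] by simp
      then show ?thesis using that cnt \<open>d \<in># y\<close> \<open>Suc i = m\<close> 3
        by (intro exI[of _ p] exI[of _ d]) (auto simp: via_def)
    qed
  qed
  from Suc.IH[OF z(1)] show ?case
  proof
    assume "?through z n"
    then show ?thesis using through by blast
  next
    assume "?edge z n"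
    then obtain a b where ab: "(a, b) \<in> parcs G" "set_mset x \<union> set_mset z \<subseteq> {a, b}"
      "count x a + count x b = m" "count z a + count z b = m"
      "count x a \<le> count z a + n" "count z a \<le> count x a + n" by blast
    have "c \<in># z" using cnt cd(2) by (simp add: count_greater_zero_iff[symmetric])
    show ?thesis
    proof (cases "i = 0")
      \<comment> \<open>At an original vertex the walk may enter a different edge, so the bound
        along the old edge is first turned into a route ending at \<open>c\<close>. In the other
        case \<open>z\<close> is an inner point, which lies on one edge only.\<close>
      case True
      then have rep: "z = replicate_mset m c" using zy subdiv_point_0 by metis
      have "a \<noteq> b" using ab(1) arc_neq by blast
      have "c = a \<or> c = b" using \<open>c \<in># z\<close> ab(2) by auto
      then have "\<exists>p. p \<in># x \<and> via x z p c \<le> n"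
      proof
        assume "c = a"
        then show ?thesis using via_along_edge[of a b x n z] ab rep \<open>a \<noteq> b\<close> by auto
      next
        assume "c = b"
        then show ?thesis using via_along_edge[of b a x n z] ab rep arc_sym \<open>a \<noteq> b\<close> by auto
      qed
      then show ?thesis using through \<open>c \<in># z\<close> by blast
    next
      case False
      then have "d \<in># z" using cnt by (simp add: count_greater_zero_iff[symmetric])
      with \<open>c \<in># z\<close> \<open>c \<noteq> d\<close> ab(2) have eq: "a = c \<and> b = d \<or> a = d \<and> b = c" by auto
      have "set_mset x \<union> set_mset y \<subseteq> {a, b}" using ab(2) sets(2) eq by auto
      moreover have "count y a + count y b = m" "count x a \<le> count y a + Suc n"
        "count y a \<le> count x a + Suc n"
        using eq cnt cd(2) ab(5,6) by auto
      ultimately have "?edge y (Suc n)" using ab(1,3) by blast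
      then show ?thesis ..
    qed
  qed
qed

text \<open>Points with a common end may be joined by a shorter path inside one edge. With disjoint
  ends, the edge alternative of \<open>walk_cases\<close> leaves only the two original vertices at
  opposite ends of an edge, and then the edge is itself such a route.\<close>

lemma gdist_H:
  assumes "x \<in> pverts H" "y \<in> pverts H" "set_mset x \<inter> set_mset y = {}"
  shows "gdist H x y = Min {via x y p q |p q. p \<in># x \<and> q \<in># y}"
proof -
  let ?S = "{via x y p q |p q. p \<in># x \<and> q \<in># y}"
  have "?S = (\<lambda>(p, q). via x y p q) ` (set_mset x \<times> set_mset y)" by auto
  then have fin: "finite ?S" by simp
  obtain p q where pq: "p \<in># x" "q \<in># y" using assms set_pverts_H(3) by (meson multiset_nonemptyE)
  define n where "n = gdist H x y"
  have n: "(x, y) \<in> parcs H ^^ n"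
    unfolding n_def using gdist_relpow[OF wf_H assms(1) path_via[OF assms(1,2) pq]] .
  have "\<exists>p q. p \<in># x \<and> q \<in># y \<and> via x y p q \<le> n"
    using walk_cases[OF assms(1) n]
  proof
    assume "\<exists>a b. (a, b) \<in> parcs G \<and> set_mset x \<union> set_mset y \<subseteq> {a, b} \<and>
       count x a + count x b = m \<and> count y a + count y b = m \<and>
       count x a \<le> count y a + n \<and> count y a \<le> count x a + n"
    then obtain a b where ab: "(a, b) \<in> parcs G" "set_mset x \<union> set_mset y \<subseteq> {a, b}"
       "count x a + count x b = m" "count y a + count y b = m"
       "count x a \<le> count y a + n" "count y a \<le> count x a + n" by blast
    have "q = a \<or> q = b" using pq ab(2) by auto
    then show ?thesis
    proof
      assume "q = a"
      then have "a \<notin># x" "b \<in># x" using ab(2) pq assms(3) by auto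
      then have "count x a = 0" "count y b = 0" "set_mset y \<subseteq> {a}"
        using ab(2) assms(3) by (auto simp: not_in_iff[symmetric])
      then have "y = replicate_mset m a" "count x b \<le> n"
        using ab by (auto simp: multiset_eq_iff) (meson not_in_iff singletonD subsetD)
      then show ?thesis using via_along_edge[of a b x n y] ab pq \<open>q = a\<close> by blast
    next
      assume "q = b"
      then have "b \<notin># x" "a \<in># x" using ab(2) pq assms(3) by auto
      then have "count x b = 0" "count y a = 0" "set_mset y \<subseteq> {b}"
        using ab(2) assms(3) by (auto simp: not_in_iff[symmetric])
      then have "y = replicate_mset m b" "count x a \<le> n"
        using ab by (auto simp: multiset_eq_iff) (meson not_in_iff singletonD subsetD)
      then show ?thesis using via_along_edge[of b a x n y] ab pq \<open>q = b\<close> arc_sym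
        by (metis Un_subset_iff add.commute insert_commute)
    qed
  qed
  then obtain p' q' where "p' \<in># x" "q' \<in># y" "via x y p' q' \<le> n" by blast
  then have "Min ?S \<le> via x y p' q'" using fin by (intro Min_le) auto
  with \<open>via x y p' q' \<le> n\<close> have "Min ?S \<le> n" by simp
  moreover have "n \<le> Min ?S"
    unfolding n_def using fin pq gdist_le[OF wf_H assms(1) path_via[OF assms(1,2)]]
    by (subst Min_ge_iff) auto
  ultimately show ?thesis unfolding n_def by simp
qed

text \<open>The probe at the robber's position answers 0, and only that vertex is at distance
  0.\<close>

lemma caught_imp_located:
  assumes "cop_strategy G k \<Sigma>" "robber_play G r" "r n \<in> set (\<Sigma> (answers G \<Sigma> r n))"
  shows "card (possible_positions G \<Sigma> r n) = 1"
proof -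
  have "possible_positions G \<Sigma> r n = {r n}"
  proof (intro equalityI subsetI)
    fix y assume "y \<in> possible_positions G \<Sigma> r n"
    then obtain r' where r': "y = r' n" "robber_play G r'"
      "answers G \<Sigma> r' (Suc n) = answers G \<Sigma> r (Suc n)" by (auto simp: possible_positions_def)
    then have "gdist G (r n) (r' n) = gdist G (r n) (r n)" using assms(3) by auto
    moreover have "r n \<in> pverts G" "r' n \<in> pverts G"
      using r' assms(2) by (auto simp: robber_play_def)
    ultimately show "y \<in> {r n}" using r' gdist_zero_iff by (metis singletonI)
  next
    fix y assume "y \<in> {r n}"
    then show "y \<in> possible_positions G \<Sigma> r n"
      using assms(2) by (auto simp: possible_positions_def)
  qed
  then show ?thesis by simp
qed

end

section \<open>Strategies given by probe rules\<close>

lemma length_answers [simp]: "length (answers G \<sigma> r n) = n"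
  by (induction n) auto

lemma answers_eq_mono:
  assumes "answers G \<sigma> r n = answers G \<sigma> r' n" "i \<le> n"
  shows "answers G \<sigma> r i = answers G \<sigma> r' i"
  using assms(2,1) by (induction rule: dec_induct) auto

definition play_class :: "'a pair_pre_digraph \<Rightarrow> 'a cop_strategy \<Rightarrow> (nat \<Rightarrow> 'a) \<Rightarrow> nat \<Rightarrow>
    (nat \<Rightarrow> 'a) set" where
  "play_class G \<sigma> r n = {r'. robber_play G r' \<and> answers G \<sigma> r' n = answers G \<sigma> r n}"

text \<open>The rule \<open>pl\<close> chooses probes from the set of plays still consistent with
  the answers, but this set depends on the strategy being built. The circle is broken by computing
  the set along the history.\<close>

lemma strategy_of_probe_rule:
  fixes pl :: "(nat \<Rightarrow> 'a) set \<Rightarrow> nat \<Rightarrow> 'a list"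
  obtains \<Sigma> where "\<And>h. \<exists>S n. \<Sigma> h = pl S n"
    and "\<And>r n. \<Sigma> (answers G \<Sigma> r n) = pl (play_class G \<Sigma> r n) n"
proof -
  \<comment> \<open>The state pairs the surviving plays with the round number. It is updated from
    the answers and \<open>pl\<close> alone, without reference to \<open>\<Sigma>\<close>.\<close>
  define step where "step = (\<lambda>(S, n) a. ({r \<in> S. map (\<lambda>p. gdist G p (r n)) (pl S n) = a}, Suc n))"
  define state where "state h = foldl step ({r. robber_play G r}, 0) h" for h
  define \<Sigma> where "\<Sigma> h = (case state h of (S, n) \<Rightarrow> pl S n)" for h
  have state: "state (answers G \<Sigma> r n) = (play_class G \<Sigma> r n, n)" for r n
  proof (induction n)
    case 0
    then show ?case by (simp add: state_def play_class_def)
  next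
    case (Suc n)
    let ?h = "answers G \<Sigma> r n"
    define C where "C = play_class G \<Sigma> r n"
    have C: "r' \<in> C \<longleftrightarrow> robber_play G r' \<and> answers G \<Sigma> r' n = ?h" for r'
      by (simp add: C_def play_class_def)
    have state_h: "state ?h = (C, n)" using Suc.IH by (simp add: C_def)
    then have \<Sigma>_h: "\<Sigma> ?h = pl C n" unfolding \<Sigma>_def by simp
    have "play_class G \<Sigma> r (Suc n)
        = {r' \<in> C. map (\<lambda>p. gdist G p (r' n)) (pl C n) = map (\<lambda>p. gdist G p (r n)) (pl C n)}"
      unfolding play_class_def using C \<Sigma>_h by auto
    then have next_class: "step (C, n) (map (\<lambda>p. gdist G p (r n)) (pl C n))
        = (play_class G \<Sigma> r (Suc n), Suc n)"
      by (simp add: step_def)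
    have "state (answers G \<Sigma> r (Suc n))
        = step (state ?h) (map (\<lambda>p. gdist G p (r n)) (\<Sigma> ?h))"
      by (simp add: state_def)
    also have "\<dots> = (play_class G \<Sigma> r (Suc n), Suc n)"
      unfolding state_h \<Sigma>_h by (rule next_class)
    finally show ?case .
  qed
  show thesis
  proof
    show "\<exists>S n. \<Sigma> h = pl S n" for h by (cases "state h") (auto simp: \<Sigma>_def)
    show "\<Sigma> (answers G \<Sigma> r n) = pl (play_class G \<Sigma> r n) n" for r n by (simp add: \<Sigma>_def state)
  qed
qed

text \<open>A strategy must probe exactly \<open>K\<close> vertices, so the list is padded with
  copies of \<open>v\<close>.\<close>

lemma ex_list_covering:
  assumes "finite A" "A \<subseteq> V" "card A \<le> K" "v \<in> V"
  shows "\<exists>l. length l = K \<and> set l \<subseteq> V \<and> A \<subseteq> set l"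
proof -
  obtain l where l: "set l = A" "length l = card A"
    using finite_distinct_list[OF assms(1)] distinct_card by metis
  then show ?thesis using assms
    by (intro exI[of _ "l @ replicate (K - card A) v"]) auto
qed

lemma sum_powers_le:
  fixes b :: nat
  assumes "b \<ge> 2"
  shows "(\<Sum>d\<le>n. b ^ d) \<le> 2 * b ^ n"
proof (induction n)
  case (Suc n)
  have "(\<Sum>d\<le>Suc n. b ^ d) \<le> 2 * b ^ n + b ^ Suc n" using Suc by simp
  also have "2 * b ^ n \<le> b ^ Suc n" using assms by simp
  finally show ?case by simp
qed simp

section \<open>Simulating the single cop\<close>

locale single_cop_win = subdivided_graph G m for G :: "'a pair_pre_digraph" and m +
  fixes \<sigma> :: "'a multiset cop_strategy" and t :: nat
  assumes strategy: "cop_strategy H 1 \<sigma>"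
    and wins: "\<And>r. robber_play H r \<Longrightarrow> \<exists>n<t. card (possible_positions H \<sigma> r n) = 1"
begin

section \<open>Lifting plays to the subdivision\<close>

definition lift :: "(nat \<Rightarrow> 'a) \<Rightarrow> nat \<Rightarrow> 'a multiset" where
  "lift r q = subdiv_point m (r (q div m)) (r (Suc (q div m))) (q mod m)"

lemma mod_m: "q mod m < m"
  using m_pos by simp

lemma lift_play:
  assumes "robber_play G r"
  shows "robber_play H (lift r)"
  unfolding robber_play_def
proof (intro conjI allI)
  fix q
  let ?k = "q div m" and ?j = "q mod m"
  have k: "r ?k \<in> pverts G" "r ?k = r (Suc ?k) \<or> (r ?k, r (Suc ?k)) \<in> parcs G"
    using assms unfolding robber_play_def by auto metis
  then show "lift r q \<in> pverts H"
    unfolding lift_def using mod_m[of q] by (intro subdiv_point_in_H) auto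
  \<comment> \<open>After the last step of a block, the end of the old edge and the start of the new
    one are the same original vertex, so one formula serves both cases.\<close>
  have next_point: "lift r (Suc q) = subdiv_point m (r ?k) (r (Suc ?k)) (Suc ?j)"
  proof (cases "Suc ?j = m")
    case True
    then have "Suc q mod m = 0" "Suc q div m = Suc ?k"
      by (auto simp: mod_Suc div_Suc)
    then show ?thesis using True unfolding lift_def
      by (simp only: subdiv_point_0 subdiv_point_end)
  next
    case False
    then have "Suc q mod m = Suc ?j" "Suc q div m = ?k"
      by (auto simp: mod_Suc div_Suc)
    then show ?thesis unfolding lift_def by simp
  qed
  show "lift r (Suc q) = lift r q \<or> (lift r q, lift r (Suc q)) \<in> parcs H"
    using k(2)
  proof
    assume "r ?k = r (Suc ?k)"
    then have "lift r (Suc q) = lift r q"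
      using next_point mod_m[of q] unfolding lift_def by (simp add: subdiv_point_same)
    then show ?thesis ..
  next
    assume "(r ?k, r (Suc ?k)) \<in> parcs G"
    then have "(lift r q, lift r (Suc q)) \<in> parcs H"
      unfolding next_point unfolding lift_def using mod_m by (intro arc_H_I)
    then show ?thesis ..
  qed
qed

definition probe :: "nat list list \<Rightarrow> 'a multiset" where
  "probe g = hd (\<sigma> g)"

lemma probe: "\<sigma> g = [probe g]" "probe g \<in> pverts H"
proof -
  have "length (\<sigma> g) = 1" "set (\<sigma> g) \<subseteq> pverts H" using strategy by (auto simp: cop_strategy_def)
  then show "\<sigma> g = [probe g]" "probe g \<in> pverts H"
    unfolding probe_def by (cases "\<sigma> g"; auto)+
qed

definition hist :: "(nat \<Rightarrow> 'a) \<Rightarrow> nat \<Rightarrow> nat list list" where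
  "hist r q = answers H \<sigma> (lift r) q"

lemma hist_0: "hist r 0 = []"
  by (simp add: hist_def)

lemma hist_Suc: "hist r (Suc q) = hist r q @ [[gdist H (probe (hist r q)) (lift r q)]]"
  by (simp add: hist_def probe(1))

text \<open>This supplies the disjointness needed for \<open>gdist_H\<close>. Where it first fails,
  an end of the probe is the robber's vertex before or after his move, and probing that end catches
  him.\<close>

definition avoids :: "(nat \<Rightarrow> 'a) \<Rightarrow> nat \<Rightarrow> bool" where
  "avoids r Q \<longleftrightarrow> (\<forall>q<Q. set_mset (probe (hist r q)) \<inter> {r (q div m), r (Suc (q div m))} = {})"

text \<open>
  The pairs \<open>(e, c)\<close> such that the lifted robber is at distance \<open>c\<close> from the end \<open>r (k + e)\<close>
  of the edge that he traverses during round \<open>k\<close>, where \<open>j\<close> is the number of steps done and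
  \<open>stay\<close> tells whether he stays at \<open>r k\<close>.
\<close>

definition ends :: "bool \<Rightarrow> nat \<Rightarrow> (nat \<times> nat) set" where
  "ends stay j = (if stay \<or> j = 0 then {(0, 0)} else {(0, j), (1, m - j)})"

lemma lift_ends:
  "(\<lambda>z. (z, m - count (lift r q) z)) ` set_mset (lift r q)
    = (\<lambda>(e, c). (r (q div m + e), c)) ` ends (r (Suc (q div m)) = r (q div m)) (q mod m)"
proof (cases "r (Suc (q div m)) = r (q div m) \<or> q mod m = 0")
  case True
  then have "lift r q = replicate_mset m (r (q div m))"
    using mod_m[of q] by (auto simp: lift_def subdiv_point_0 subdiv_point_same)
  then show ?thesis using True m_pos by (simp add: ends_def)
next
  case False
  then have "lift r q = replicate_mset (m - q mod m) (r (q div m))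
    + replicate_mset (q mod m) (r (Suc (q div m)))" by (simp add: lift_def subdiv_point_def)
  then show ?thesis using False mod_m[of q] by (auto simp: ends_def)
qed

text \<open>By \<open>lift_ends\<close> the lifted robber enters \<open>gdist_H\<close> only through
  the stay bit, the position in the block and the distances in \<open>G\<close> to
  \<open>r k\<close> and \<open>r (k + 1)\<close>. Hence the answer is known once round
  \<open>k + 1\<close> has been probed.\<close>

lemma answer_eq:
  assumes "robber_play G r" "x \<in> pverts H" "set_mset x \<inter> {r (q div m), r (Suc (q div m))} = {}"
  shows "gdist H x (lift r q) = Min ((\<lambda>(p, e, c). (m - count x p) + m * gdist G p (r (q div m + e)) + c) `
    (set_mset x \<times> ends (r (Suc (q div m)) = r (q div m)) (q mod m)))"
proof -
  let ?E = "ends (r (Suc (q div m)) = r (q div m)) (q mod m)"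
  have "set_mset x \<inter> set_mset (lift r q) = {}"
    using assms(3) set_subdiv_point unfolding lift_def by fast
  then have "gdist H x (lift r q) = Min {via x (lift r q) p z |p z. p \<in># x \<and> z \<in># lift r q}"
    using gdist_H assms lift_play[OF assms(1)] by (simp add: robber_play_def)
  also have "{via x (lift r q) p z |p z. p \<in># x \<and> z \<in># lift r q}
    = (\<lambda>(p, z, c). (m - count x p) + m * gdist G p z + c) `
      (set_mset x \<times> (\<lambda>z. (z, m - count (lift r q) z)) ` set_mset (lift r q))"
    by (force simp: via_def)
  also have "\<dots> = (\<lambda>(p, e, c). (m - count x p) + m * gdist G p (r (q div m + e)) + c) `
    (set_mset x \<times> ?E)"
    unfolding lift_ends by force
  finally show ?thesis .
qed

lemma answer_cong:
  assumes "robber_play G r" "robber_play G r'" "x \<in> pverts H"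
    and "set_mset x \<inter> {r (q div m), r (Suc (q div m))} = {}"
    and "set_mset x \<inter> {r' (q div m), r' (Suc (q div m))} = {}"
    and "r (Suc (q div m)) = r (q div m) \<longleftrightarrow> r' (Suc (q div m)) = r' (q div m)"
    and "\<And>p. p \<in># x \<Longrightarrow> gdist G p (r (q div m)) = gdist G p (r' (q div m))"
    and "\<And>p. p \<in># x \<Longrightarrow> gdist G p (r (Suc (q div m))) = gdist G p (r' (Suc (q div m)))"
  shows "gdist H x (lift r q) = gdist H x (lift r' q)"
proof -
  have "(\<lambda>(p, e, c). (m - count x p) + m * gdist G p (r (q div m + e)) + c) `
      (set_mset x \<times> ends stay j)
    = (\<lambda>(p, e, c). (m - count x p) + m * gdist G p (r' (q div m + e)) + c) `
      (set_mset x \<times> ends stay j)" for stay j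
  proof (intro image_cong refl)
    fix z assume "z \<in> set_mset x \<times> ends stay j"
    then obtain p e c where z: "z = (p, e, c)" "p \<in># x" "(e, c) \<in> ends stay j" by auto
    have "e = 0 \<or> e = 1" using z(3) by (auto simp: ends_def split: if_splits)
    then have "gdist G p (r (q div m + e)) = gdist G p (r' (q div m + e))"
      using assms(7,8)[OF z(2)] by auto
    then show "(case z of (p, e, c) \<Rightarrow> (m - count x p) + m * gdist G p (r (q div m + e)) + c)
      = (case z of (p, e, c) \<Rightarrow> (m - count x p) + m * gdist G p (r' (q div m + e)) + c)"
      by (simp add: z(1))
  qed
  then show ?thesis
    by (simp only: answer_eq[OF assms(1,3,4)] answer_eq[OF assms(2,3,5)] assms(6))
qed

section \<open>Counting answers and histories\<close>

definition replies :: "'a multiset \<Rightarrow> bool \<Rightarrow> nat \<Rightarrow> nat set" where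
  "replies x stay j = (\<lambda>((p, e, c), D). (m - count x p) + m * D + c) `
    ((set_mset x \<times> ends stay j) \<times> {1..graph_diameter G})"

lemma card_ends: "finite (ends stay j)" "card (ends stay j) \<le> 2"
  by (auto simp: ends_def)

text \<open>There are at most two ends of the probe, two ends for the robber and
  \<open>\<delta>\<close> distances; distance 0 is excluded since the probe avoids the
  robber.\<close>

lemma card_replies:
  assumes "x \<in> pverts H"
  shows "finite (replies x stay j)" "card (replies x stay j) \<le> 4 * graph_diameter G"
proof -
  let ?A = "(set_mset x \<times> ends stay j) \<times> {1..graph_diameter G}"
  show "finite (replies x stay j)" unfolding replies_def by (simp add: card_ends)
  have "card (replies x stay j) \<le> card ?A"
    unfolding replies_def by (intro card_image_le) (simp add: card_ends)
  also have "\<dots> = (card (set_mset x) * card (ends stay j)) * graph_diameter G"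
    by (simp add: card_cartesian_product)
  also have "\<dots> \<le> (2 * 2) * graph_diameter G"
    using set_pverts_H(2)[OF assms] card_ends(2) by (intro mult_le_mono) auto
  finally show "card (replies x stay j) \<le> 4 * graph_diameter G" by simp
qed

lemma answer_in_replies:
  assumes "robber_play G r" "x \<in> pverts H" "set_mset x \<inter> {r (q div m), r (Suc (q div m))} = {}"
  shows "gdist H x (lift r q) \<in> replies x (r (Suc (q div m)) = r (q div m)) (q mod m)"
proof -
  let ?E = "ends (r (Suc (q div m)) = r (q div m)) (q mod m)"
  let ?f = "\<lambda>(p, e, c). (m - count x p) + m * gdist G p (r (q div m + e)) + c"
  have "?E \<noteq> {}" by (auto simp: ends_def)
  then have "gdist H x (lift r q) \<in> ?f ` (set_mset x \<times> ?E)"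
    unfolding answer_eq[OF assms] using set_pverts_H(3)[OF assms(2)] card_ends(1)
    by (intro Min_in) auto
  then obtain p e c where pec: "p \<in># x" "(e, c) \<in> ?E" "gdist H x (lift r q) = ?f (p, e, c)" by auto
  have "e = 0 \<or> e = 1" using pec(2) by (auto simp: ends_def split: if_splits)
  then have "p \<noteq> r (q div m + e)" using assms(3) pec(1) by auto
  moreover have V: "p \<in> pverts G" "r (q div m + e) \<in> pverts G"
    using set_pverts_H(1)[OF assms(2)] pec(1) assms(1) by (auto simp: robber_play_def)
  ultimately have "gdist G p (r (q div m + e)) \<in> {1..graph_diameter G}"
    using gdist_zero_iff[OF V] gdist_le_diameter[OF V] by simp
  then show ?thesis unfolding replies_def using pec by force
qed

text \<open>The set \<open>s\<close> is a guess of the rounds in which the robber stays. It includes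
  round \<open>N\<close>, because \<open>Q\<close> may run through the block of that round.\<close>

definition histories :: "(nat \<Rightarrow> 'a) set \<Rightarrow> nat \<Rightarrow> nat set \<Rightarrow> nat \<Rightarrow> nat list list set" where
  "histories R N s Q = {hist r Q |r. r \<in> R \<and> {k. k \<le> N \<and> r (Suc k) = r k} = s \<and> avoids r Q}"

text \<open>This is what the probes of rounds before \<open>N\<close> provide: plays in
  \<open>R\<close> look alike from every vertex that matters for answer \<open>q\<close>, in the
  rounds before and after the move traversed at time \<open>q\<close>.\<close>

definition agreeing :: "(nat \<Rightarrow> 'a) set \<Rightarrow> nat \<Rightarrow> bool" where
  "agreeing R N \<longleftrightarrow> (\<forall>r\<in>R. robber_play G r) \<and>
    (\<forall>r\<in>R. \<forall>r'\<in>R. \<forall>q i. \<forall>p \<in># probe (hist r q).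
      avoids r q \<and> (i = q div m \<or> i = Suc (q div m)) \<and> i < N \<longrightarrow> gdist G p (r i) = gdist G p (r' i))"

lemma agreeingD:
  assumes "agreeing R N" "r \<in> R" "r' \<in> R" "avoids r q" "p \<in># probe (hist r q)"
    and "i = q div m \<or> i = Suc (q div m)" "i < N"
  shows "gdist G p (r i) = gdist G p (r' i)"
  using assms unfolding agreeing_def by blast

text \<open>An answer in a block before \<open>N - 1\<close> depends only on rounds before
  \<open>N\<close>, so agreement and the stay bits determine it. Every later answer costs a factor
  \<open>4 * graph_diameter G\<close>. Truncated subtraction makes the exponent 0 until
  then.\<close>

lemma card_histories:
  assumes R: "agreeing R N" and "Q \<le> m * (N + 1)"
  shows "finite (histories R N s Q) \<and>
    card (histories R N s Q) \<le> (4 * graph_diameter G) ^ (Q - m * (N - 1))"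
  using assms(2)
proof (induction Q)
  case 0
  have sub: "histories R N s 0 \<subseteq> {[]}" by (auto simp: histories_def hist_0)
  then show ?case using card_mono[OF _ sub] by (auto intro: finite_subset[OF sub])
next
  case (Suc Q)
  let ?k = "Q div m" and ?b = "4 * graph_diameter G"
  have IH: "finite (histories R N s Q)" "card (histories R N s Q) \<le> ?b ^ (Q - m * (N - 1))"
    using Suc by auto
  have "?k < N + 1" using Suc.prems by (intro less_mult_imp_div_less) (simp add: mult.commute)
  then have kN: "?k \<le> N" by simp
  let ?A = "SIGMA g : histories R N s Q. replies (probe g) (?k \<in> s) (Q mod m)"
  have sub: "histories R N s (Suc Q) \<subseteq> (\<lambda>(g, y). g @ [[y]]) ` ?A"
  proof
    fix g assume "g \<in> histories R N s (Suc Q)"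
    then obtain r where r: "g = hist r (Suc Q)" "r \<in> R" "{k. k \<le> N \<and> r (Suc k) = r k} = s"
      "avoids r (Suc Q)" by (auto simp: histories_def)
    have "avoids r Q" using r(4) by (simp add: avoids_def)
    with r have "hist r Q \<in> histories R N s Q" by (auto simp: histories_def)
    moreover have "gdist H (probe (hist r Q)) (lift r Q)
        \<in> replies (probe (hist r Q)) (r (Suc ?k) = r ?k) (Q mod m)"
      using r R by (intro answer_in_replies probe) (auto simp: agreeing_def avoids_def)
    moreover have "r (Suc ?k) = r ?k \<longleftrightarrow> ?k \<in> s" using r(3) kN by auto
    ultimately show "g \<in> (\<lambda>(g, y). g @ [[y]]) ` ?A" unfolding r(1) hist_Suc by force
  qed
  have finA: "finite ?A" using IH card_replies(1) probe(2) by (intro finite_SigmaI) auto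
  then have fin: "finite (histories R N s (Suc Q))" using sub by (meson finite_imageI finite_subset)
  have "card (histories R N s (Suc Q)) \<le> ?b ^ (Suc Q - m * (N - 1))"
  proof (cases "Q < m * (N - 1)")
    case True
    then have "?k < N - 1" by (intro less_mult_imp_div_less) (simp add: mult.commute)
    have "card (histories R N s Q) \<le> Suc 0" using IH True by simp
    then have single: "g = g'" if "g \<in> histories R N s Q" "g' \<in> histories R N s Q" for g g'
      using that IH(1) by (auto simp: card_le_Suc0_iff_eq)
    have "g = g'" if "g \<in> histories R N s (Suc Q)" "g' \<in> histories R N s (Suc Q)" for g g'
    proof -
      from that obtain r r' where r: "g = hist r (Suc Q)" "r \<in> R"
        "{k. k \<le> N \<and> r (Suc k) = r k} = s" "avoids r (Suc Q)"
        and r': "g' = hist r' (Suc Q)" "r' \<in> R"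
        "{k. k \<le> N \<and> r' (Suc k) = r' k} = s" "avoids r' (Suc Q)"
        unfolding histories_def by blast
      have av: "avoids r Q" "avoids r' Q" using r(4) r'(4) by (auto simp: avoids_def)
      then have h: "hist r Q = hist r' Q"
        using r r' by (intro single) (auto simp: histories_def)
      have "gdist H (probe (hist r Q)) (lift r Q) = gdist H (probe (hist r Q)) (lift r' Q)"
      proof (rule answer_cong)
        show "robber_play G r" "robber_play G r'" using R r r' by (auto simp: agreeing_def)
        show "probe (hist r Q) \<in> pverts H" by (rule probe)
        show "set_mset (probe (hist r Q)) \<inter> {r ?k, r (Suc ?k)} = {}"
          "set_mset (probe (hist r Q)) \<inter> {r' ?k, r' (Suc ?k)} = {}"
          using r(4) r'(4) h by (auto simp: avoids_def)
        show "r (Suc ?k) = r ?k \<longleftrightarrow> r' (Suc ?k) = r' ?k" using r(3) r'(3) kN by blast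
        show "gdist G p (r ?k) = gdist G p (r' ?k)"
          "gdist G p (r (Suc ?k)) = gdist G p (r' (Suc ?k))" if "p \<in># probe (hist r Q)" for p
          using agreeingD[OF R r(2) r'(2) av(1) that] \<open>?k < N - 1\<close> by auto
      qed
      then show "g = g'" unfolding r(1) r'(1) hist_Suc using h by simp
    qed
    then have "card (histories R N s (Suc Q)) \<le> Suc 0" using fin by (simp add: card_le_Suc0_iff_eq)
    then show ?thesis using True by simp
  next
    case False
    have "card (histories R N s (Suc Q)) \<le> card ((\<lambda>(g, y). g @ [[y]]) ` ?A)"
      using sub finA by (intro card_mono) auto
    also have "\<dots> \<le> card ?A" using finA by (rule card_image_le)
    also have "\<dots> = (\<Sum>g\<in>histories R N s Q. card (replies (probe g) (?k \<in> s) (Q mod m)))"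
      using IH(1) card_replies(1) probe(2) by (intro card_SigmaI) auto
    also have "\<dots> \<le> card (histories R N s Q) * ?b"
      using card_replies(2) probe(2) sum_bounded_above[of "histories R N s Q"
          "\<lambda>g. card (replies (probe g) (?k \<in> s) (Q mod m))" ?b] by simp
    also have "\<dots> \<le> ?b ^ (Q - m * (N - 1)) * ?b" using IH(2) by simp
    also have "\<dots> = ?b ^ (Suc Q - m * (N - 1))" using False by (simp add: Suc_diff_le)
    finally show ?thesis .
  qed
  with fin show ?case ..
qed

section \<open>The vertices to probe\<close>

definition located :: "nat list list \<Rightarrow> 'a multiset set" where
  "located g = {\<rho> (length g - 1) |\<rho>. robber_play H \<rho> \<and> answers H \<sigma> \<rho> (length g) = g}"

definition marks :: "nat list list \<Rightarrow> 'a set" where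
  "marks g = set_mset (probe g) \<union> (if card (located g) = 1 then \<Union>(set_mset ` located g) else {})"

lemma marks: "marks g \<subseteq> pverts G" "finite (marks g)" "card (marks g) \<le> 4"
proof -
  let ?L = "if card (located g) = 1 then \<Union>(set_mset ` located g) else {}"
  have L: "?L \<subseteq> pverts G \<and> finite ?L \<and> card ?L \<le> 2"
  proof (cases "card (located g) = 1")
    case True
    then obtain x where x: "located g = {x}" by (auto simp: card_1_singleton_iff)
    then have "x \<in> located g" by simp
    then have "x \<in> pverts H" by (auto simp: located_def robber_play_def)
    then show ?thesis using x set_pverts_H by simp
  qed simp
  have P: "set_mset (probe g) \<subseteq> pverts G" "card (set_mset (probe g)) \<le> 2"
    using set_pverts_H[OF probe(2)] by auto
  show "marks g \<subseteq> pverts G" "finite (marks g)" unfolding marks_def using L P by auto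
  show "card (marks g) \<le> 4"
    unfolding marks_def using card_Un_le[of "set_mset (probe g)" ?L] L P by linarith
qed

text \<open>A hit in round \<open>N\<close> comes from a history whose current block is
  \<open>N - 1\<close> or \<open>N\<close>, which gives this window. Its closed upper end admits the
  history just after the last answer of block \<open>N\<close>.\<close>

definition targets :: "(nat \<Rightarrow> 'a) set \<Rightarrow> nat \<Rightarrow> 'a set" where
  "targets R N = (\<Union>r\<in>R. \<Union>Q\<in>{Q\<in>{m * (N - 1)..m * (N + 1)}. avoids r Q}. marks (hist r Q))"

lemma targets_subset: "targets R N \<subseteq> pverts G"
  using marks(1) by (auto simp: targets_def)

text \<open>The factors count the sets of stay rounds within \<open>0..N\<close>, the histories over
  a window of length at most \<open>2 * m\<close> (a geometric sum), and the marks of each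
  history.\<close>

lemma card_targets:
  assumes R: "agreeing R N" and diam: "graph_diameter G \<ge> 1"
  shows "finite (targets R N)"
    "card (targets R N) \<le> 2 ^ (N + 1) * (2 * (4 * graph_diameter G) ^ (2 * m)) * 4"
proof -
  let ?b = "4 * graph_diameter G" and ?a = "m * (N - 1)" and ?c = "m * (N + 1)"
  let ?U = "\<lambda>s. \<Union>Q\<in>{?a..?c}. histories R N s Q"
  let ?W = "\<Union>s\<in>Pow {..N}. ?U s"
  have eq: "targets R N = (\<Union>g\<in>?W. marks g)" (is "_ = ?T")
  proof
    show "targets R N \<subseteq> ?T"
    proof
      fix v assume "v \<in> targets R N"
      then obtain r Q where rQ: "r \<in> R" "Q \<in> {?a..?c}" "avoids r Q" "v \<in> marks (hist r Q)"
        by (auto simp: targets_def)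
      let ?s = "{k. k \<le> N \<and> r (Suc k) = r k}"
      have "?s \<in> Pow {..N}" by auto
      moreover have "hist r Q \<in> histories R N ?s Q" using rQ by (auto simp: histories_def)
      ultimately show "v \<in> ?T" using rQ by blast
    qed
    show "?T \<subseteq> targets R N" unfolding targets_def histories_def by blast
  qed
  have finU: "finite (?U s)" for s using card_histories[OF R] by auto
  then have finW: "finite ?W" by auto
  show "finite (targets R N)" unfolding eq using finW marks(2) by blast
  have cU: "card (?U s) \<le> 2 * ?b ^ (2 * m)" for s
  proof -
    have "card (?U s) \<le> (\<Sum>Q\<in>{?a..?c}. card (histories R N s Q))" by (rule card_UN_le) simp
    also have "\<dots> \<le> (\<Sum>Q\<in>{?a..?c}. ?b ^ (Q - ?a))" using card_histories[OF R] by (intro sum_mono) auto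
    also have "\<dots> = (\<Sum>d\<in>(\<lambda>Q. Q - ?a) ` {?a..?c}. ?b ^ d)"
      by (subst sum.reindex) (auto simp: inj_on_def)
    also have "\<dots> \<le> (\<Sum>d\<le>2 * m. ?b ^ d)"
    proof (intro sum_mono2)
      have "?c \<le> ?a + 2 * m" by (cases N) (auto simp: algebra_simps)
      then show "(\<lambda>Q. Q - ?a) ` {?a..?c} \<subseteq> {..2 * m}" by auto
    qed auto
    also have "\<dots> \<le> 2 * ?b ^ (2 * m)" using diam by (intro sum_powers_le) auto
    finally show ?thesis .
  qed
  have "card ?W \<le> (\<Sum>s\<in>Pow {..N}. card (?U s))" by (rule card_UN_le) simp
  also have "\<dots> \<le> card (Pow {..N}) * (2 * ?b ^ (2 * m))"
    using cU sum_bounded_above[of "Pow {..N}" "\<lambda>s. card (?U s)" "2 * ?b ^ (2 * m)"] by simp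
  finally have cW: "card ?W \<le> 2 ^ (N + 1) * (2 * ?b ^ (2 * m))" by (simp add: card_Pow)
  have "card (targets R N) \<le> (\<Sum>g\<in>?W. card (marks g))" unfolding eq by (rule card_UN_le) (rule finW)
  also have "\<dots> \<le> card ?W * 4"
    using marks(3) sum_bounded_above[of ?W "\<lambda>g. card (marks g)" 4] by simp
  also have "\<dots> \<le> 2 ^ (N + 1) * (2 * ?b ^ (2 * m)) * 4" by (rule mult_le_mono1[OF cW])
  finally show "card (targets R N) \<le> 2 ^ (N + 1) * (2 * ?b ^ (2 * m)) * 4" .
qed

section \<open>The strategy with many cops\<close>

lemma localizable_bound:
  assumes diam: "graph_diameter G \<ge> 1"
  shows "localizable G (32 * 2 ^ (t div m) * (4 * graph_diameter G) ^ (2 * m))"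
    (is "localizable G ?K")
proof -
  \<comment> \<open>The rule must be defined for all \<open>S\<close> and \<open>N\<close>, so
    covering is demanded only when the targets fit into \<open>?K\<close> probes. For the classes
    that arise in play, \<open>covered\<close> shows that they do fit.\<close>
  define good where "good S N l \<longleftrightarrow> length l = ?K \<and> set l \<subseteq> pverts G \<and>
    (card (targets S N) \<le> ?K \<and> finite (targets S N) \<longrightarrow> targets S N \<subseteq> set l)" for S N l
  define pl where "pl S N = (SOME l. good S N l)" for S N
  obtain v where v: "v \<in> pverts G" using pverts_ne by blast
  have pl: "good S N (pl S N)" for S N
  proof -
    have "\<exists>l. good S N l"
    proof (cases "card (targets S N) \<le> ?K \<and> finite (targets S N)")
      case True
      then show ?thesis using ex_list_covering[OF _ targets_subset _ v]
        unfolding good_def by blast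
    next
      case False
      then show ?thesis using v unfolding good_def by (intro exI[of _ "replicate ?K v"]) auto
    qed
    then show ?thesis unfolding pl_def by (rule someI_ex)
  qed
  obtain \<Sigma> where \<Sigma>: "\<And>h. \<exists>S n. \<Sigma> h = pl S n"
    and \<Sigma>_answers: "\<And>r n. \<Sigma> (answers G \<Sigma> r n) = pl (play_class G \<Sigma> r n) n"
    using strategy_of_probe_rule[of pl G] by blast
  have cop: "cop_strategy G ?K \<Sigma>"
    unfolding cop_strategy_def using \<Sigma> pl unfolding good_def by metis
  let ?T = "t div m + 1"
  have target_mem: "p \<in> targets (play_class G \<Sigma> r i) i"
    if "robber_play G r" "avoids r Q" "m * (i - 1) \<le> Q" "Q \<le> m * (i + 1)" "p \<in> marks (hist r Q)"
    for r i Q p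
    using that unfolding targets_def play_class_def by auto
  have near: "m * (i - 1) \<le> q \<and> q \<le> m * (i + 1)" if "i = q div m \<or> i = Suc (q div m)" for i q
  proof -
    have "m * (q div m) \<le> q" "q \<le> m * (q div m + 1)"
      using mod_m[of q] mult_div_mod_eq[of m q] unfolding distrib_left by linarith+
    moreover have "m * (i - 1) \<le> m * (q div m)" "m * (q div m + 1) \<le> m * (i + 1)"
      using that by (auto intro!: mult_le_mono2)
    ultimately show ?thesis by linarith
  qed
  \<comment> \<open>Strong induction: probing all targets in earlier rounds makes the current class
    agreeing, which bounds its targets by \<open>?K\<close>, so they are probed as well.\<close>
  have covered: "targets (play_class G \<Sigma> r N) N \<subseteq> set (\<Sigma> (answers G \<Sigma> r N))"
    if "N \<le> ?T" for r N
    using that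
  proof (induction N arbitrary: r rule: less_induct)
    case (less N)
    let ?R = "play_class G \<Sigma> r N"
    have "agreeing ?R N"
      unfolding agreeing_def
    proof (intro conjI ballI allI impI)
      show "robber_play G r'" if "r' \<in> ?R" for r' using that by (simp add: play_class_def)
      fix r1 r2 q i p
      assume r12: "r1 \<in> ?R" "r2 \<in> ?R" and p: "p \<in># probe (hist r1 q)"
        and i: "avoids r1 q \<and> (i = q div m \<or> i = Suc (q div m)) \<and> i < N"
      \<comment> \<open>The induction hypothesis is applied to the play \<open>r1\<close>. As
        \<open>p\<close> was probed in round \<open>i < N\<close> and both plays have the same
        answers through that round, they are equally far from \<open>p\<close>.\<close>
      have "p \<in> targets (play_class G \<Sigma> r1 i) i"
        using r12 i near[of i q] p by (intro target_mem[of r1 q]) (auto simp: play_class_def marks_def)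
      then have mem: "p \<in> set (\<Sigma> (answers G \<Sigma> r1 i))" using less i by auto
      have "answers G \<Sigma> r1 N = answers G \<Sigma> r2 N" using r12 by (simp add: play_class_def)
      then have "answers G \<Sigma> r1 (Suc i) = answers G \<Sigma> r2 (Suc i)"
        by (rule answers_eq_mono) (use i in auto)
      then show "gdist G p (r1 i) = gdist G p (r2 i)" using mem by auto
    qed
    note ct = card_targets[OF this diam]
    \<comment> \<open>With \<open>N \<le> t div m + 1\<close> this power contributes a factor 4, and
      the 2 and 4 from \<open>card_targets\<close> complete the constant 32.\<close>
    have "(2::nat) ^ (N + 1) \<le> 2 ^ (t div m + 2)" using less.prems by (intro power_increasing) auto
    then have "(2::nat) ^ (N + 1) * (2 * (4 * graph_diameter G) ^ (2 * m)) * 4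
        \<le> 2 ^ (t div m + 2) * (2 * (4 * graph_diameter G) ^ (2 * m)) * 4" by (intro mult_le_mono) auto
    also have "\<dots> = ?K" by simp
    finally have "card (targets ?R N) \<le> ?K" using ct(2) by linarith
    then show ?case unfolding \<Sigma>_answers using pl[of ?R N] ct(1) unfolding good_def by blast
  qed
  have "\<exists>n<?T + 1. card (possible_positions G \<Sigma> r n) = 1" if r: "robber_play G r" for r
  proof -
    have hit: ?thesis if "avoids r Q" "i = k \<or> i = Suc k" "m * (i - 1) \<le> Q" "Q \<le> m * (i + 1)"
      "r i \<in> marks (hist r Q)" "k * m < t" for Q i k
    proof -
      have "k \<le> t div m" using that(6) m_pos by (simp add: less_eq_div_iff_mult_less_eq)
      then have "i \<le> ?T" using that(2) by auto
      then have "r i \<in> set (\<Sigma> (answers G \<Sigma> r i))"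
        using covered target_mem[OF r that(1,3,4,5)] by blast
      then show ?thesis using caught_imp_located[OF cop r] \<open>i \<le> ?T\<close> by (auto simp: less_Suc_eq_le)
    qed
    obtain q where q: "q < t" "card (possible_positions H \<sigma> (lift r) q) = 1"
      using wins[OF lift_play[OF r]] by blast
    show ?thesis
    proof (cases "avoids r (Suc q)")
      \<comment> \<open>The single cop locates the lifted robber unhindered. Since
        \<open>q mod m < m\<close>, the vertex \<open>r (q div m)\<close> is an end of the located
        point and hence marked.\<close>
      case True
      have "located (hist r (Suc q)) = possible_positions H \<sigma> (lift r) q"
        by (auto simp: located_def possible_positions_def hist_def simp del: answers.simps)
      moreover have "lift r q \<in> possible_positions H \<sigma> (lift r) q"
        using lift_play[OF r] by (auto simp: possible_positions_def)
      moreover have "r (q div m) \<in># lift r q"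
        using mod_m[of q] by (auto simp: lift_def subdiv_point_def)
      ultimately have "r (q div m) \<in> marks (hist r (Suc q))"
        using q(2) by (auto simp: marks_def)
      moreover have "Suc q \<le> m * (q div m + 1)"
        using mod_m[of q] mult_div_mod_eq[of m q] unfolding distrib_left by linarith
      moreover have "m * (q div m - 1) \<le> Suc q" using near[of "q div m" q] by simp
      moreover have "q div m * m < t" using q(1) by (meson div_times_less_eq_dividend le_less_trans)
      ultimately show ?thesis using hit[OF True, of "q div m" "q div m"] by blast
    next
      case False
      \<comment> \<open>At the first failure the earlier answers still form an avoiding history. The
        vertex hit may belong to round \<open>Suc (Q div m)\<close>, which is why \<open>?T\<close>
        exceeds \<open>t div m\<close> by one.\<close>
      define Q where "Q = (LEAST Q. set_mset (probe (hist r Q)) \<inter> {r (Q div m), r (Suc (Q div m))} \<noteq> {})"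
      obtain q' where q': "q' < Suc q"
        "set_mset (probe (hist r q')) \<inter> {r (q' div m), r (Suc (q' div m))} \<noteq> {}"
        using False unfolding avoids_def by blast
      have Q: "set_mset (probe (hist r Q)) \<inter> {r (Q div m), r (Suc (Q div m))} \<noteq> {}"
        unfolding Q_def by (rule LeastI) (rule q'(2))
      have "Q \<le> q'" unfolding Q_def by (rule Least_le) (rule q'(2))
      then have "Q < t" using q'(1) q(1) by simp
      have av: "avoids r Q" unfolding avoids_def using not_less_Least unfolding Q_def by blast
      obtain i where i: "i = Q div m \<or> i = Suc (Q div m)" "r i \<in># probe (hist r Q)" using Q by auto
      moreover have "Q div m * m < t"
        using \<open>Q < t\<close> by (meson div_times_less_eq_dividend le_less_trans)
      ultimately show ?thesis using hit[OF av i(1)] near[OF i(1)] by (auto simp: marks_def)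
    qed
  qed
  then show ?thesis using cop unfolding localizable_def wins_within_def by blast
qed

end

section \<open>The final bound\<close>

lemma localizable_zero:
  assumes "pverts G = {v}"
  shows "localizable G 0"
proof -
  have "card (possible_positions G (\<lambda>_. []) r 0) = 1" if "robber_play G r" for r
  proof -
    have start: "r' 0 = v" if "robber_play G r'" for r'
      using that unfolding robber_play_def assms by blast
    have "possible_positions G (\<lambda>_. []) r 0 = {v}"
    proof
      show "possible_positions G (\<lambda>_. []) r 0 \<subseteq> {v}"
        unfolding possible_positions_def using start by blast
      show "{v} \<subseteq> possible_positions G (\<lambda>_. []) r 0"
        unfolding possible_positions_def using start[OF that] that by blast
    qed
    then show ?thesis by simp
  qed
  then show ?thesis
    unfolding localizable_def wins_within_def cop_strategy_def
    by (intro exI[of _ 1] exI[of _ "\<lambda>_. []"]) auto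
qed

theorem theorem4:
  shows "\<exists>C::real. C > 0 \<and>
    (\<forall>(G :: 'a pair_pre_digraph) \<eta> capt \<delta>.
       pair_graph G \<and> Digraph_Component.connected (with_proj G) \<and>
       is_subdivision_number G \<eta> \<and>
       capt = capture_time (uniform_subdivision \<eta> G) \<and>
       \<delta> = graph_diameter G \<longrightarrow>
       real (localization_number G)
         \<le> C * (2 powr (real capt / real \<eta>) * 16 ^ \<eta> * real \<delta> ^ (2 * \<eta>)))"
proof (intro exI[of _ 32] conjI allI impI)
  fix G :: "'a pair_pre_digraph" and \<eta> capt \<delta>
  assume asm: "pair_graph G \<and> Digraph_Component.connected (with_proj G) \<and>
       is_subdivision_number G \<eta> \<and>
       capt = capture_time (uniform_subdivision \<eta> G) \<and>
       \<delta> = graph_diameter G"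
  then have \<eta>: "\<eta> \<ge> 1" "localizable (uniform_subdivision \<eta> G) 1"
    by (auto simp: is_subdivision_number_def)
  interpret subdivided_graph G \<eta>
    using asm \<eta> by (simp add: subdivided_graph_def subdivided_graph_axioms_def)
  show "real (localization_number G)
      \<le> 32 * (2 powr (real capt / real \<eta>) * 16 ^ \<eta> * real \<delta> ^ (2 * \<eta>))"
  proof (cases "\<delta> = 0")
    \<comment> \<open>As \<open>\<eta>\<close> is positive, the right-hand side is 0, so no cop at
      all may be used. The graph is a single vertex, where the robber is located without
      probes.\<close>
    case True
    obtain v where v: "v \<in> pverts G" using pverts_ne by blast
    have "u = v" if "u \<in> pverts G" for u
      using gdist_le_diameter[OF that v] gdist_zero_iff[OF that v] True asm by simp
    with v have "pverts G = {v}" by blast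
    then have "localizable G 0" by (rule localizable_zero)
    then have "localization_number G = 0" unfolding localization_number_def by (rule Least_eq_0)
    then show ?thesis by simp
  next
    case False
    have "wins_within (uniform_subdivision \<eta> G) 1 capt"
      using asm LeastI_ex[OF \<eta>(2)[unfolded localizable_def]] by (simp add: capture_time_def)
    then obtain \<sigma> where \<sigma>: "cop_strategy (uniform_subdivision \<eta> G) 1 \<sigma>"
      "\<And>r. robber_play (uniform_subdivision \<eta> G) r \<Longrightarrow>
        \<exists>n<capt. card (possible_positions (uniform_subdivision \<eta> G) \<sigma> r n) = 1"
      unfolding wins_within_def by blast
    interpret single_cop_win G \<eta> \<sigma> capt by unfold_locales (use \<sigma> in auto)
    have "localization_number G \<le> 32 * 2 ^ (capt div \<eta>) * (4 * \<delta>) ^ (2 * \<eta>)"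
      unfolding localization_number_def using localizable_bound False asm by (intro Least_le) simp
    then have "real (localization_number G) \<le> real (32 * 2 ^ (capt div \<eta>) * (4 * \<delta>) ^ (2 * \<eta>))"
      by (simp only: of_nat_le_iff)
    \<comment> \<open>The factor \<open>16 ^ \<eta>\<close> is \<open>4 ^ (2 * \<eta>)\<close>,
      split off from the power of \<open>4 * \<delta>\<close>.\<close>
    also have "\<dots> = 32 * (2 ^ (capt div \<eta>) * 16 ^ \<eta> * real \<delta> ^ (2 * \<eta>))"
      by (simp add: power_mult_distrib power_mult)
    also have "\<dots> \<le> 32 * (2 powr (real capt / real \<eta>) * 16 ^ \<eta> * real \<delta> ^ (2 * \<eta>))"
    proof -
      have "(2::real) ^ (capt div \<eta>) = 2 powr real (capt div \<eta>)" by (simp add: powr_realpow)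
      also have "\<dots> \<le> 2 powr (real capt / real \<eta>)"
        using of_nat_div_le_of_nat[of capt \<eta>, where 'a = real] by (intro powr_mono) auto
      finally show ?thesis by (intro mult_left_mono mult_right_mono) auto
    qed
    finally show ?thesis .
  qed
qed simp

end
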